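(* Let $n\in\{1,\dots,N\}$ and keep $M_0,M_1,\alpha,\rho,p_u,\beta_1,\dots,\beta_N,\theta_1,\dots,\theta_N,k,d$ fixed. Let $R_{\mathrm{P},n}$ be the closed-form approximate uplink achievable rate of user $n$ (MRC receiver, perfect CSI) given in the context, regarded as a function of the Rician factors $K_1,\dots,K_N$. If all users' Rician factors tend to infinity, i.e. $K_i\to\infty$ for every $i=1,\dots,N$, then $$R_{\mathrm{P},n}\to \log_2\left(1+\frac{p_u\beta_n (M_0+\alpha M_1)^2}{p_u\sum_{i\ne n}\beta_i\left(\phi_{ni,0}^2+\alpha^2\phi_{ni,1}^2\right)+M_0+\alpha M_1+\alpha\rho p_u M_1\sum_{i=1}^N\beta_i}\right).$$
   Context: Parameters of a mixed-ADC massive MIMO uplink: $N\ge 1$ users; $M=M_0+M_1\geq 1$ base-station antennas, $M_0\ge 0$ with high-resolution ADCs and $M_1\ge 0$ with low-resolution ADCs; distortion factor $\rho\in[0,1)$ of the low-resolution ADCs and $\alpha=1-\rho$; transmit power $p_u>0$; large-scale fading coefficients $\beta_i>0$; Rician factors $K_i\ge 0$; arrival angles $\theta_i\in\mathbb{R}$; real constants $k,d>0$ (only the product $kd$ matters). For $i\neq n$ and $j=0,1$ put $$\phi_{ni,j}=\frac{\sin\left(M_j kd(\sin\theta_n-\sin\theta_i)/2\right)}{\sin\left(kd(\sin\theta_n-\sin\theta_i)/2\right)},$$ where it is assumed that $\sin\left(kd(\sin\theta_n-\sin\theta_i)/2\right)\ne 0$ for all $i\ne n$, so that these are defined. Further put,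 for $i\ne n$ and $j=0,1$, $$\Delta_j=\Delta_j^{(i)}=\frac{K_nK_i\phi_{ni,j}^2+M_j(K_n+K_i+1)}{K_i+1},\qquad \Delta_2=M_1\left[\beta_n(K_n^2+4K_n+2)+(K_n+1)^2\sum_{i\neq n}\beta_i\right].$$ The closed-form approximate rate is $$R_{\mathrm{P},n}=\log_2\left(1+\frac{p_u\beta_n\left[(2K_n+1)(M_0+\alpha^2M_1)+(K_n+1)^2(M_0+\alpha M_1)^2\right]}{p_u(K_n+1)\sum_{i\ne n}\beta_i\left(\Delta_0^{(i)}+\alpha^2\Delta_1^{(i)}\right)+(K_n+1)^2(M_0+\alpha M_1)+\alpha\rho p_u\Delta_2}\right).$$ *)

theory Defs
  imports "HOL-Analysis.Analysis"
begin

text \<open>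
  Users are indexed by \<open>{1..N}\<close>; families indexed by users are functions on \<^typ>\<open>nat\<close> of which
  only the values on \<open>{1..N}\<close> are used.
\<close>

definition phase :: "real \<Rightarrow> real \<Rightarrow> (nat \<Rightarrow> real) \<Rightarrow> nat \<Rightarrow> nat \<Rightarrow> real" where
  "phase k d \<theta> n i = k * d * (sin (\<theta> n) - sin (\<theta> i)) / 2"

text \<open>
  \<open>phi k d \<theta> M\<^sub>j n i\<close> is \<open>\<phi>\<^bsub>ni,j\<^esub>\<close>; it is meaningful only if \<open>sin (phase k d \<theta> n i) \<noteq> 0\<close>.
\<close>

definition phi :: "real \<Rightarrow> real \<Rightarrow> (nat \<Rightarrow> real) \<Rightarrow> nat \<Rightarrow> nat \<Rightarrow> nat \<Rightarrow> real" where
  "phi k d \<theta> M n i = sin (real M * phase k d \<theta> n i) / sin (phase k d \<theta> n i)"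

text \<open>\<open>Delta k d \<theta> K n i M\<^sub>j\<close> is \<open>\<Delta>\<^sub>j\<^bsup>(i)\<^esup>\<close> for \<open>j = 0, 1\<close>.\<close>

definition Delta ::
  "real \<Rightarrow> real \<Rightarrow> (nat \<Rightarrow> real) \<Rightarrow> (nat \<Rightarrow> real) \<Rightarrow> nat \<Rightarrow> nat \<Rightarrow> nat \<Rightarrow> real" where
  "Delta k d \<theta> K n i M =
     (K n * K i * (phi k d \<theta> M n i)\<^sup>2 + real M * (K n + K i + 1)) / (K i + 1)"

definition Delta2 :: "nat \<Rightarrow> nat \<Rightarrow> (nat \<Rightarrow> real) \<Rightarrow> (nat \<Rightarrow> real) \<Rightarrow> nat \<Rightarrow> real" where
  "Delta2 N M1 \<beta> K n =
     real M1 * (\<beta> n * ((K n)\<^sup>2 + 4 * K n + 2) + (K n + 1)\<^sup>2 * (\<Sum>i\<in>{1..N} - {n}. \<beta> i))"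

definition rate_P ::
  "nat \<Rightarrow> nat \<Rightarrow> nat \<Rightarrow> real \<Rightarrow> real \<Rightarrow> real \<Rightarrow> (nat \<Rightarrow> real) \<Rightarrow> (nat \<Rightarrow> real) \<Rightarrow> real \<Rightarrow> real
    \<Rightarrow> nat \<Rightarrow> (nat \<Rightarrow> real) \<Rightarrow> real" where
  "rate_P N M0 M1 \<alpha> \<rho> p\<^sub>u \<beta> \<theta> k d n K =
     log 2 (1 +
       (p\<^sub>u * \<beta> n * ((2 * K n + 1) * (real M0 + \<alpha>\<^sup>2 * real M1)
                     + (K n + 1)\<^sup>2 * (real M0 + \<alpha> * real M1)\<^sup>2)) /
       (p\<^sub>u * (K n + 1)
            * (\<Sum>i\<in>{1..N} - {n}. \<beta> i * (Delta k d \<theta> K n i M0 + \<alpha>\<^sup>2 * Delta k d \<theta> K n i M1))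
          + (K n + 1)\<^sup>2 * (real M0 + \<alpha> * real M1)
          + \<alpha> * \<rho> * p\<^sub>u * Delta2 N M1 \<beta> K n))"

text \<open>
  The filter for ``\<open>K i \<longlonglongrightarrow> \<infinity>\<close> for every user \<open>i\<close>'': a joint limit in \<open>(K 1, \<dots>, K N)\<close>, with
  no relation between the rates at which the components grow.
\<close>

definition all_at_top :: "nat \<Rightarrow> (nat \<Rightarrow> real) filter" where
  "all_at_top N = (INF i\<in>{1..N}. filtercomap (\<lambda>K. K i) at_top)"

lemma eventually_all_at_top:
  "eventually P (all_at_top N) \<longleftrightarrow> (\<exists>C. \<forall>K. (\<forall>i\<in>{1..N}. K i \<ge> C) \<longrightarrow> P K)"
proof
  assume "eventually P (all_at_top N)"
  then obtain Q where Q: "\<forall>i\<in>{1..N}. eventually (Q i) (filtercomap (\<lambda>K. K i) at_top)"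
    and QP: "\<forall>K. (\<forall>i\<in>{1..N}. Q i K) \<longrightarrow> P K"
    unfolding all_at_top_def by (subst (asm) eventually_INF_finite) auto
  have "\<forall>i\<in>{1..N}. \<exists>c::real. \<forall>K. K i \<ge> c \<longrightarrow> Q i K"
    using Q by (force simp: eventually_filtercomap eventually_at_top_linorder)
  then obtain c :: "nat \<Rightarrow> real" where c: "\<And>i K. i \<in> {1..N} \<Longrightarrow> K i \<ge> c i \<Longrightarrow> Q i K"
    by metis
  have "P K" if K: "\<forall>i\<in>{1..N}. K i \<ge> (\<Sum>j\<in>{1..N}. \<bar>c j\<bar>)" for K
  proof -
    have "c i \<le> K i" if "i \<in> {1..N}" for i
      using K that member_le_sum[of i "{1..N}" "\<lambda>j. \<bar>c j\<bar>"] by fastforce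
    then show ?thesis using QP c by blast
  qed
  then show "\<exists>C. \<forall>K. (\<forall>i\<in>{1..N}. K i \<ge> C) \<longrightarrow> P K" by blast
next
  assume "\<exists>C. \<forall>K. (\<forall>i\<in>{1..N}. K i \<ge> C) \<longrightarrow> P K"
  then obtain C where C: "\<And>K. (\<forall>i\<in>{1..N}. K i \<ge> C) \<Longrightarrow> P K" by blast
  have "eventually (\<lambda>K. K i \<ge> C) (all_at_top N)" if "i \<in> {1..N}" for i
    unfolding all_at_top_def
    by (rule eventually_INF1[OF that], rule eventually_filtercomapI, rule eventually_ge_at_top)
  then have "eventually (\<lambda>K. \<forall>i\<in>{1..N}. K i \<ge> C) (all_at_top N)"
    by (simp add: eventually_ball_finite_distrib)
  then show "eventually P (all_at_top N)"
    by (rule eventually_mono) (use C in blast)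
qed

text \<open>The standing assumption \<open>K i \<ge> 0\<close> therefore holds eventually along this filter.\<close>

lemma eventually_nonneg_all_at_top: "\<forall>\<^sub>F K in all_at_top N. \<forall>i\<in>{1..N}. K i \<ge> 0"
  unfolding eventually_all_at_top by blast

lemma all_at_top_neq_bot: "all_at_top N \<noteq> bot"
proof
  assume "all_at_top N = bot"
  then have "eventually (\<lambda>_. False) (all_at_top N)" by simp
  then obtain C where "\<forall>K::nat \<Rightarrow> real. \<not> (\<forall>i\<in>{1..N}. K i \<ge> C)"
    unfolding eventually_all_at_top by blast
  from spec[OF this, of "\<lambda>_. C"] show False by simp
qed

end

theory Submission
  imports Defs
begin

text \<open>
  Divide the numerator and the denominator of the signal-to-noise ratio by \<open>(K n + 1)\<^sup>2\<close> and
  substitute \<open>u i = 1 / (K i + 1)\<close>. The ratio becomes a quotient of polynomials in the \<open>u i\<close>, so the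
  joint limit is obtained at \<open>u = 0\<close>, where the denominator is at least \<open>M0 + \<alpha> * M1 > 0\<close>.
\<close>

text \<open>\<open>all_at_top N\<close> is an infimum of filters, one of which is the pullback of
  \<open>at_top\<close> along \<open>K i\<close>; hence each coordinate diverges by itself, whatever
  the others do.\<close>

lemma tendsto_inverse_all_at_top:
  assumes "i \<in> {1..N}"
  shows "((\<lambda>K. inverse (K i + 1)) \<longlongrightarrow> 0) (all_at_top N)"
proof -
  have "filterlim (\<lambda>K::nat \<Rightarrow> real. K i) at_top (all_at_top N)"
    unfolding all_at_top_def
    by (rule filterlim_INF'[OF assms filterlim_filtercomap])
  then have "filterlim (\<lambda>K. 1 + K i) at_top (all_at_top N)"
    by (rule filterlim_tendsto_add_at_top[OF tendsto_const])
  then show ?thesis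
    by (simp add: add.commute tendsto_inverse_0_at_top)
qed

text \<open>Uses \<open>K j = (K j + 1) * (1 - u j)\<close> and the fact that
  \<open>K n + K i + 1\<close> divided by \<open>(K n + 1) * (K i + 1)\<close> is
  \<open>u n + u i - u n * u i\<close>. Only one factor \<open>K n + 1\<close> comes out; the second
  one is explicit in \<open>rate_P\<close>.\<close>

lemma Delta_rescaled:
  assumes "K n \<ge> 0" "K i \<ge> 0"
  defines "u \<equiv> \<lambda>j. inverse (K j + 1)"
  shows "Delta k d \<theta> K n i M =
    (K n + 1) * ((1 - u n) * (1 - u i) * (phi k d \<theta> M n i)\<^sup>2 + real M * (u n + u i - u n * u i))"
proof -
  have "K n + 1 \<noteq> 0" "K i + 1 \<noteq> 0" using assms(1,2) by auto
  then show ?thesis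
    unfolding Delta_def u_def by (simp add: divide_simps)
qed

text \<open>Completing the square gives \<open>(K n)\<^sup>2 + 4 * K n + 2 = (K n + 1)\<^sup>2 + 2 *
  (K n + 1) - 1\<close>, and each missing factor \<open>K n + 1\<close> is supplied as
  \<open>1 / u\<close>.\<close>

lemma Delta2_rescaled:
  assumes "K n \<ge> 0"
  defines "u \<equiv> inverse (K n + 1)"
  shows "Delta2 N M1 \<beta> K n =
    (K n + 1)\<^sup>2 * (real M1 * (\<beta> n * (1 + 2 * u - u\<^sup>2) + (\<Sum>i\<in>{1..N} - {n}. \<beta> i)))"
proof -
  have unit: "(K n + 1) * u = 1" using assms(1) by (simp add: u_def)
  have "(K n + 1)\<^sup>2 * (1 + 2 * u - u\<^sup>2)
      = (K n + 1)\<^sup>2 + 2 * (K n + 1) * ((K n + 1) * u) - ((K n + 1) * u)\<^sup>2"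
    by (simp add: algebra_simps power2_eq_square)
  then have quad: "(K n)\<^sup>2 + 4 * K n + 2 = (K n + 1)\<^sup>2 * (1 + 2 * u - u\<^sup>2)"
    unfolding unit by (simp add: algebra_simps power2_eq_square)
  show ?thesis
    unfolding Delta2_def quad by (simp only: distrib_left mult_ac)
qed

text \<open>An exact identity, not an asymptotic one: numerator and denominator both carry the
  factor \<open>(K n + 1)\<^sup>2\<close>, which cancels and leaves polynomials in the
  \<open>u i\<close>.\<close>

lemma rate_P_rescaled:
  fixes K :: "nat \<Rightarrow> real"
  assumes "n \<in> {1..N}" and "\<forall>i\<in>{1..N}. K i \<ge> 0"
  defines "u \<equiv> \<lambda>i. inverse (K i + 1)"
  shows "rate_P N M0 M1 \<alpha> \<rho> p\<^sub>u \<beta> \<theta> k d n K =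
    log 2 (1 +
      (p\<^sub>u * \<beta> n * ((2 * u n - (u n)\<^sup>2) * (real M0 + \<alpha>\<^sup>2 * real M1)
                    + (real M0 + \<alpha> * real M1)\<^sup>2)) /
      (p\<^sub>u * (\<Sum>i\<in>{1..N} - {n}. \<beta> i *
              (((1 - u n) * (1 - u i) * (phi k d \<theta> M0 n i)\<^sup>2 + real M0 * (u n + u i - u n * u i))
               + \<alpha>\<^sup>2 * ((1 - u n) * (1 - u i) * (phi k d \<theta> M1 n i)\<^sup>2
                       + real M1 * (u n + u i - u n * u i))))
         + (real M0 + \<alpha> * real M1)
         + \<alpha> * \<rho> * p\<^sub>u * (real M1 * (\<beta> n * (1 + 2 * u n - (u n)\<^sup>2)
                                   + (\<Sum>i\<in>{1..N} - {n}. \<beta> i)))))"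
    (is "_ = log 2 (1 + ?A / (p\<^sub>u * (\<Sum>i\<in>?I. \<beta> i * ?D i) + ?B + \<alpha> * \<rho> * p\<^sub>u * ?E))")
proof -
  have Kn: "K n \<ge> 0" and nz: "K n + 1 \<noteq> 0"
    using assms(1,2) by force+
  have num: "p\<^sub>u * \<beta> n * ((2 * K n + 1) * (real M0 + \<alpha>\<^sup>2 * real M1) + (K n + 1)\<^sup>2 * ?B\<^sup>2)
      = (K n + 1)\<^sup>2 * ?A"
  proof -
    have unit: "(K n + 1) * u n = 1" using nz by (simp add: u_def)
    \<comment> \<open>After \<open>unit\<close> the right-hand side is
      \<open>2 * (K n + 1) - 1\<close>, that is \<open>2 * K n + 1\<close>.\<close>
    have "(K n + 1)\<^sup>2 * (2 * u n - (u n)\<^sup>2)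
        = 2 * (K n + 1) * ((K n + 1) * u n) - ((K n + 1) * u n)\<^sup>2"
      by (simp add: algebra_simps power2_eq_square)
    then have "2 * K n + 1 = (K n + 1)\<^sup>2 * (2 * u n - (u n)\<^sup>2)"
      unfolding unit by simp
    then show ?thesis by (simp only: distrib_left mult_ac)
  qed
  have "(\<Sum>i\<in>?I. \<beta> i * (Delta k d \<theta> K n i M0 + \<alpha>\<^sup>2 * Delta k d \<theta> K n i M1))
      = (\<Sum>i\<in>?I. (K n + 1) * (\<beta> i * ?D i))"
  proof (rule sum.cong[OF refl])
    fix i assume "i \<in> ?I"
    then have "K i \<ge> 0" using assms(2) by auto
    then show "\<beta> i * (Delta k d \<theta> K n i M0 + \<alpha>\<^sup>2 * Delta k d \<theta> K n i M1)
        = (K n + 1) * (\<beta> i * ?D i)"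
      unfolding u_def Delta_rescaled[where K = K and n = n and i = i, OF Kn \<open>K i \<ge> 0\<close>] by (simp only: distrib_left mult_ac)
  qed
  also have "\<dots> = (K n + 1) * (\<Sum>i\<in>?I. \<beta> i * ?D i)"
    by (rule sum_distrib_left[symmetric])
  finally have sum: "(\<Sum>i\<in>?I. \<beta> i * (Delta k d \<theta> K n i M0 + \<alpha>\<^sup>2 * Delta k d \<theta> K n i M1))
      = (K n + 1) * (\<Sum>i\<in>?I. \<beta> i * ?D i)" .
  have D2: "Delta2 N M1 \<beta> K n = (K n + 1)\<^sup>2 * ?E"
    unfolding u_def by (rule Delta2_rescaled[where K = K and n = n, OF Kn])
  have den: "p\<^sub>u * (K n + 1) * ((K n + 1) * S) + (K n + 1)\<^sup>2 * B + \<alpha> * \<rho> * p\<^sub>u * ((K n + 1)\<^sup>2 * E)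
      = (K n + 1)\<^sup>2 * (p\<^sub>u * S + B + \<alpha> * \<rho> * p\<^sub>u * E)" for S B E
    by (simp add: algebra_simps power2_eq_square)
  \<comment> \<open>No sign condition on \<open>b\<close> is required: for \<open>b = 0\<close> both
    quotients are 0.\<close>
  have cancel: "(K n + 1)\<^sup>2 * a / ((K n + 1)\<^sup>2 * b) = a / b" for a b
    using nz by simp
  show ?thesis
    unfolding rate_P_def num sum D2 den cancel ..
qed

theorem mainTheorem1:
  fixes N M0 M1 n :: nat
    and \<alpha> \<rho> p\<^sub>u k d :: real
    and \<beta> \<theta> :: "nat \<Rightarrow> real"
  assumes "N \<ge> 1"
    and "M0 + M1 \<ge> 1"
    and "0 \<le> \<rho>" and "\<rho> < 1"
    and "\<alpha> = 1 - \<rho>"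
    and "p\<^sub>u > 0"
    and "k > 0" and "d > 0"
    and "\<forall>i\<in>{1..N}. \<beta> i > 0"
    and "n \<in> {1..N}"
    and "\<forall>i\<in>{1..N} - {n}. sin (k * d * (sin (\<theta> n) - sin (\<theta> i)) / 2) \<noteq> 0"
  shows "((\<lambda>K. rate_P N M0 M1 \<alpha> \<rho> p\<^sub>u \<beta> \<theta> k d n K) \<longlongrightarrow>
           log 2 (1 +
             (p\<^sub>u * \<beta> n * (real M0 + \<alpha> * real M1)\<^sup>2) /
             (p\<^sub>u * (\<Sum>i\<in>{1..N} - {n}. \<beta> i * ((phi k d \<theta> M0 n i)\<^sup>2 + \<alpha>\<^sup>2 * (phi k d \<theta> M1 n i)\<^sup>2))
                + real M0 + \<alpha> * real M1
                + \<alpha> * \<rho> * p\<^sub>u * real M1 * (\<Sum>i\<in>{1..N}. \<beta> i))))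
         (all_at_top N)"
proof -
  define u :: "nat \<Rightarrow> (nat \<Rightarrow> real) \<Rightarrow> real" where "u = (\<lambda>i K. inverse (K i + 1))"
  define I where "I = {1..N} - {n}"
  define B where "B = real M0 + \<alpha> * real M1"
  define A where "A = (\<lambda>K. p\<^sub>u * \<beta> n *
      ((2 * u n K - (u n K)\<^sup>2) * (real M0 + \<alpha>\<^sup>2 * real M1) + B\<^sup>2))"
  define D where "D = (\<lambda>K. p\<^sub>u * (\<Sum>i\<in>I. \<beta> i *
         (((1 - u n K) * (1 - u i K) * (phi k d \<theta> M0 n i)\<^sup>2
           + real M0 * (u n K + u i K - u n K * u i K))
          + \<alpha>\<^sup>2 * ((1 - u n K) * (1 - u i K) * (phi k d \<theta> M1 n i)\<^sup>2
                  + real M1 * (u n K + u i K - u n K * u i K))))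
      + B + \<alpha> * \<rho> * p\<^sub>u * (real M1 * (\<beta> n * (1 + 2 * u n K - (u n K)\<^sup>2) + (\<Sum>i\<in>I. \<beta> i))))"
  define S where "S = (\<Sum>i\<in>I. \<beta> i * ((phi k d \<theta> M0 n i)\<^sup>2 + \<alpha>\<^sup>2 * (phi k d \<theta> M1 n i)\<^sup>2))"
  \<comment> \<open>The value of \<open>D\<close> at \<open>u = 0\<close>.\<close>
  define L where "L = p\<^sub>u * S + B + \<alpha> * \<rho> * p\<^sub>u * (real M1 * (\<beta> n + (\<Sum>i\<in>I. \<beta> i)))"
  have \<alpha>: "\<alpha> > 0" using assms(4,5) by simp
  have \<beta>: "\<beta> n > 0" "\<And>i. i \<in> I \<Longrightarrow> \<beta> i > 0" using assms(9,10) by (auto simp: I_def)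
  \<comment> \<open>If \<open>M0 = 0\<close> then \<open>M1\<close> is at least 1 and \<alpha> > 0
    makes the second summand positive; otherwise the first one is.\<close>
  have "B > 0"
    using \<alpha> assms(2) by (cases "M0 = 0") (auto simp: B_def intro!: add_pos_nonneg)
  moreover have "S \<ge> 0"
    unfolding S_def using \<beta>(2) by (intro sum_nonneg) (simp add: less_imp_le)
  moreover have "\<beta> n + (\<Sum>i\<in>I. \<beta> i) \<ge> 0"
    using \<beta> by (intro add_nonneg_nonneg sum_nonneg) (auto intro: less_imp_le)
  ultimately have L: "L > 0"
    unfolding L_def using \<alpha> assms(3,6) by (intro add_pos_nonneg add_nonneg_pos) auto
  have "p\<^sub>u * \<beta> n * B\<^sup>2 / L \<ge> 0"
    using L \<beta>(1) assms(6) by simp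
  then have pos: "1 + p\<^sub>u * \<beta> n * B\<^sup>2 / L > 0" by linarith
  have u: "(u i \<longlongrightarrow> 0) (all_at_top N)" if "i \<in> {1..N}" for i
    unfolding u_def by (rule tendsto_inverse_all_at_top[OF that])
  note un = u[OF assms(10)]
  \<comment> \<open>The limit keeps its zeros unsimplified, so that it mirrors the shape of
    \<open>A\<close> and the limit rules apply term by term; the same is done for
    \<open>D\<close>.\<close>
  have "(A \<longlongrightarrow> p\<^sub>u * \<beta> n * ((2 * 0 - 0\<^sup>2) * (real M0 + \<alpha>\<^sup>2 * real M1) + B\<^sup>2)) (all_at_top N)"
    unfolding A_def by (intro tendsto_intros un)
  then have A: "(A \<longlongrightarrow> p\<^sub>u * \<beta> n * B\<^sup>2) (all_at_top N)" by simp
  have "(D \<longlongrightarrow> p\<^sub>u * (\<Sum>i\<in>I. \<beta> i *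
         (((1 - 0) * (1 - 0) * (phi k d \<theta> M0 n i)\<^sup>2 + real M0 * (0 + 0 - 0 * 0))
          + \<alpha>\<^sup>2 * ((1 - 0) * (1 - 0) * (phi k d \<theta> M1 n i)\<^sup>2 + real M1 * (0 + 0 - 0 * 0))))
      + B + \<alpha> * \<rho> * p\<^sub>u * (real M1 * (\<beta> n * (1 + 2 * 0 - 0\<^sup>2) + (\<Sum>i\<in>I. \<beta> i)))) (all_at_top N)"
    unfolding D_def by (intro tendsto_intros un u) (auto simp: I_def)
  then have D: "(D \<longlongrightarrow> L) (all_at_top N)" by (simp add: L_def S_def)
  \<comment> \<open>\<open>L > 0\<close> and \<open>pos\<close> provide the side conditions for the
    limits of the quotient and of the logarithm.\<close>
  have "((\<lambda>K. log 2 (1 + A K / D K)) \<longlongrightarrow> log 2 (1 + p\<^sub>u * \<beta> n * B\<^sup>2 / L)) (all_at_top N)"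
    using L pos by (intro tendsto_intros A D) auto
  \<comment> \<open>The rescaled form is available only for nonnegative Rician factors, which is
    eventually the case along the filter.\<close>
  moreover have "\<forall>\<^sub>F K in all_at_top N.
      log 2 (1 + A K / D K) = rate_P N M0 M1 \<alpha> \<rho> p\<^sub>u \<beta> \<theta> k d n K"
    using eventually_nonneg_all_at_top
    by eventually_elim
      (simp only: rate_P_rescaled[OF assms(10)] A_def D_def B_def I_def u_def)
  ultimately have lim: "((\<lambda>K. rate_P N M0 M1 \<alpha> \<rho> p\<^sub>u \<beta> \<theta> k d n K) \<longlongrightarrow>
      log 2 (1 + p\<^sub>u * \<beta> n * B\<^sup>2 / L)) (all_at_top N)"
    by (rule Lim_transform_eventually)
  \<comment> \<open>The quantization term of user \<open>n\<close> itself survives with weight 1 and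
    completes the interferers' sum to a sum over all users.\<close>
  have "(\<Sum>i\<in>{1..N}. \<beta> i) = \<beta> n + (\<Sum>i\<in>I. \<beta> i)"
    unfolding I_def by (rule sum.remove[OF _ assms(10)]) simp
  then have "L = p\<^sub>u * S + real M0 + \<alpha> * real M1
      + \<alpha> * \<rho> * p\<^sub>u * real M1 * (\<Sum>i\<in>{1..N}. \<beta> i)"
    unfolding L_def B_def by simp
  with lim show ?thesis
    unfolding S_def B_def I_def by simp
qed

end
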